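(* Let $\nu>0$ with $\nu\neq1$. If $X,Y\in\mathcal{F}_\nu$ are independent, then $X+Y\notin\mathcal{F}_\nu$. Moreover, a COM-Poisson distribution of order $\nu$ (i.e. $\mathrm{CMP}(\lambda,\nu)$ with any $\lambda>0$) with $\nu\ne1$ is not a discrete compound Poisson (DCP) distribution.
   Context: For $\lambda,\nu>0$, $X\sim\mathrm{CMP}(\lambda,\nu)$ (COM-Poisson distribution of order $\nu$) means $P(X=k)=\frac{\lambda^k}{(k!)^\nu}\cdot\frac{1}{Z(\lambda,\nu)}$ for $k=0,1,2,\dots$, where $Z(\lambda,\nu)=\sum_{i=0}^\infty\frac{\lambda^i}{(i!)^\nu}$. For fixed $\nu>0$, $\mathcal{F}_\nu$ is the family of COM-Poisson random variables of order $\nu$: $X\in\mathcal{F}_\nu$ iff $X\sim\mathrm{CMP}(\lambda,\nu)$ for some $\lambda>0$. A random variable $X$ with values in $\{0,1,2,\dots\}$ is discrete compound Poisson (DCP) distributed if its probability generating function has the form $\sum_{n=0}^\infty P(X=n)z^n=\exp\left(\sum_{k=1}^\infty\alpha_k\lambda(z^k-1)\right)$ for $|z|\le1$, where $\lambda>0$, all $\alpha_k\ge0$, and $\sum_{k=1}^\infty\lambda\alpha_k<\infty$. *)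

theory Defs
  imports "HOL-Probability.Probability"
begin

definition CMP_Z :: "real \<Rightarrow> real \<Rightarrow> real" where
  "CMP_Z lam nu = (\<Sum>i. lam ^ i / (fact i) powr nu)"

definition CMP_distributed :: "'a measure \<Rightarrow> ('a \<Rightarrow> nat) \<Rightarrow> real \<Rightarrow> real \<Rightarrow> bool" where
  "CMP_distributed M X lam nu \<longleftrightarrow>
     X \<in> measurable M (count_space UNIV) \<and>
     (\<forall>k. \<P>(\<omega> in M. X \<omega> = k) = lam ^ k / (fact k) powr nu * (1 / CMP_Z lam nu))"

definition CMP_family :: "'a measure \<Rightarrow> real \<Rightarrow> ('a \<Rightarrow> nat) set" where
  "CMP_family M nu = {X. \<exists>lam>0. CMP_distributed M X lam nu}"

definition pgf :: "'a measure \<Rightarrow> ('a \<Rightarrow> nat) \<Rightarrow> complex \<Rightarrow> complex" where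
  "pgf M X z = (\<Sum>n. complex_of_real (\<P>(\<omega> in M. X \<omega> = n)) * z ^ n)"

text \<open>
  The sums over \<open>k \<ge> 1\<close> are indexed by \<open>Suc k\<close>; the value \<open>\<alpha> 0\<close> plays no role.
  The weights \<open>\<alpha>\<close> are not required to sum to 1.
\<close>
definition DCP_distributed :: "'a measure \<Rightarrow> ('a \<Rightarrow> nat) \<Rightarrow> bool" where
  "DCP_distributed M X \<longleftrightarrow>
     X \<in> measurable M (count_space UNIV) \<and>
     (\<exists>(lam :: real) (\<alpha> :: nat \<Rightarrow> real).
        lam > 0 \<and> (\<forall>k\<ge>1. \<alpha> k \<ge> 0) \<and> summable (\<lambda>k. lam * \<alpha> (Suc k)) \<and>
        (\<forall>z. norm z \<le> 1 \<longrightarrow>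
           pgf M X z = exp (\<Sum>k. complex_of_real (\<alpha> (Suc k) * lam) * (z ^ Suc k - 1))))"

end

theory Submission
  imports Defs "HOL-Complex_Analysis.Laurent_Convergence" "HOL-Real_Asymp.Real_Asymp"
begin

text \<open>
  Each claim reduces to a comparison of coefficients of generating functions that is
  consistent only for \<open>nu = 1\<close>.

  \<^bold>\<open>Sums.\<close> Let \<open>X\<close>, \<open>Y\<close> and \<open>X + Y\<close> have parameters \<open>a\<close>, \<open>b\<close>, \<open>c\<close>. Equality of
  the probabilities of the value 0 matches the normalising constants, the value 1 then gives
  \<open>a + b = c\<close>, and the value 2 gives \<open>(a + b)\<^sup>2 = a\<^sup>2 + b\<^sup>2 + 2 powr nu * a * b\<close>. Hence
  \<open>2 powr nu = 2\<close>.

  \<^bold>\<open>Compound Poisson.\<close> For a discrete compound Poisson variable, the logarithmic derivative of the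
  generating function has nonnegative coefficients \<open>r k\<close>, and its point probabilities \<open>p\<close> obey
  \<open>(n + 1) * p (n + 1) = (\<Sum>k\<le>n. r k * p (n - k))\<close> (\<open>DCP_recursion\<close>). For the
  COM-Poisson probabilities, the powers of \<open>lam\<close> can be absorbed into \<open>r\<close>, which leaves a
  recursion between powers of factorials. Growth rates in \<open>n\<close> show that it has a
  nonnegative solution only if \<open>nu = 1\<close> (\<open>nonneg_convolution_imp_exponent_eq_1\<close>). This is an
  elementary form of a function-theoretic argument: for \<open>nu < 1\<close>, the series \<open>CMP_Z\<close> is an entire
  function of order \<open>1 / nu\<close>; if it is the exponential of a series with nonnegative
  coefficients, then that series is a polynomial of degree \<open>1 / nu\<close>, and this polynomial must
  contain a linear term that the coefficient asymptotics exclude.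
\<close>

section \<open>A recursion between powers of factorials\<close>

lemma fact_quotient_bounds:
  shows "(real m + 1) ^ j \<le> fact (m + j) / fact m"
    and "fact (m + j) / fact m \<le> (real (m + j)) ^ j"
proof -
  show "(real m + 1) ^ j \<le> fact (m + j) / fact m"
  proof (induction j)
    case (Suc j)
    have "(real m + 1) ^ Suc j \<le> (real m + 1 + real j) * (fact (m + j) / fact m)"
      unfolding power_Suc by (intro mult_mono Suc) auto
    then show ?case by (simp add: algebra_simps)
  qed simp
  show "fact (m + j) / fact m \<le> (real (m + j)) ^ j"
  proof (induction j)
    case (Suc j)
    have "fact (m + j) / fact m \<le> real (m + Suc j) ^ j"
      by (rule order_trans[OF Suc power_mono]) auto
    then have "real (m + Suc j) * (fact (m + j) / fact m) \<le> real (m + Suc j) ^ Suc j"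
      unfolding power_Suc by (intro mult_left_mono) auto
    then show ?case by (simp add: algebra_simps)
  qed simp
qed

text \<open>
  Multiplying the recursion by \<open>(n + 1)!\<close> to the power \<open>nu\<close> turns it into
  \<open>n + 1 = (\<Sum>k\<le>n. s k * q n k)\<close>, where \<open>q n k\<close> is the \<open>nu\<close>-th power of a product
  of \<open>k + 1\<close> consecutive integers, the largest being \<open>n + 1\<close>, so that \<open>q n k\<close> grows like
  \<open>n\<close> to the power \<open>(k + 1) * nu\<close>. As all terms are nonnegative, each is at most
  \<open>n + 1\<close>: this forces \<open>s k = 0\<close> whenever \<open>(k + 1) * nu > 1\<close>, and only finitely many
  terms remain. Among these, only a term with \<open>(k + 1) * nu = 1\<close> grows linearly, so such a
  \<open>k\<close> exists and has \<open>s k = 1\<close>. This term already equals \<open>n\<close> up to a bounded error, which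
  leaves no room for the unbounded term \<open>s 0 * q n 0\<close>. The two terms coincide only
  if \<open>nu = 1\<close>.
\<close>
lemma nonneg_convolution_imp_exponent_eq_1:
  fixes nu :: real and s :: "nat \<Rightarrow> real"
  assumes "nu > 0" and s_nonneg: "\<And>k. s k \<ge> 0"
    and conv: "\<And>n. (real n + 1) / fact (Suc n) powr nu = (\<Sum>k\<le>n. s k / fact (n - k) powr nu)"
  shows "nu = 1"
proof (rule ccontr)
  assume "nu \<noteq> 1"
  define q :: "nat \<Rightarrow> nat \<Rightarrow> real" where "q n k = (fact (Suc n) / fact (n - k)) powr nu" for n k
  have q_nonneg: "q n k \<ge> 0" for n k by (simp add: q_def)
  have q_lower: "(real n + 1 - real k) powr (real (Suc k) * nu) \<le> q n k"
    and q_upper: "q n k \<le> (real n + 1) powr (real (Suc k) * nu)" if "k \<le> n" for n k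
  proof -
    have *: "n - k + Suc k = Suc n" "real (n - k) + 1 = real n + 1 - real k"
      using that by auto
    have "((real n + 1 - real k) ^ Suc k) powr nu \<le> q n k"
      using fact_quotient_bounds(1)[of "n - k" "Suc k"] that \<open>nu > 0\<close> unfolding q_def *
      by (intro powr_mono2) auto
    also have "(real n + 1 - real k) ^ Suc k = (real n + 1 - real k) powr real (Suc k)"
      using that by (intro powr_realpow[symmetric]) auto
    finally show "(real n + 1 - real k) powr (real (Suc k) * nu) \<le> q n k"
      by (simp only: powr_powr)
    have "q n k \<le> (real (Suc n) ^ Suc k) powr nu"
      using fact_quotient_bounds(2)[of "n - k" "Suc k"] that \<open>nu > 0\<close> unfolding q_def *
      by (intro powr_mono2) auto
    also have "real (Suc n) ^ Suc k = real (Suc n) powr real (Suc k)"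
      by (intro powr_realpow[symmetric]) auto
    finally show "q n k \<le> (real n + 1) powr (real (Suc k) * nu)"
      by (simp only: powr_powr of_nat_Suc add.commute)
  qed
  have sum_eq: "(\<Sum>k\<le>n. s k * q n k) = real n + 1" for n
  proof -
    have "(\<Sum>k\<le>n. s k * q n k) = fact (Suc n) powr nu * (\<Sum>k\<le>n. s k / fact (n - k) powr nu)"
      unfolding sum_distrib_left by (intro sum.cong refl) (simp add: q_def powr_divide)
    also have "\<dots> = real n + 1"
      by (subst conv[symmetric]) (simp del: fact_Suc)
    finally show ?thesis .
  qed
  have s0: "s 0 = 1"
    using sum_eq[of 0] by (simp add: q_def)
  \<comment> \<open>The case \<open>nu > 1\<close> already fails at \<open>n = 1\<close>, where \<open>s 1\<close> would have to be negative.\<close>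
  have "nu < 1"
  proof -
    have "2 powr nu + s 1 * 2 powr nu = 2"
      using sum_eq[of 1] s0 by (simp add: q_def)
    then have "2 powr nu \<le> 2 powr 1"
      using mult_nonneg_nonneg[OF s_nonneg[of 1] powr_ge_zero[of 2 nu]] by simp
    then have "nu \<le> 1"
      by (subst (asm) powr_le_cancel_iff) auto
    with \<open>nu \<noteq> 1\<close> show ?thesis by simp
  qed
  have s_zero: "s k = 0" if k: "real (Suc k) * nu > 1" for k
  proof -
    have "(\<lambda>n. (real n + 1) / (real n + 1 - real k) powr (real (Suc k) * nu)) \<longlonglongrightarrow> 0"
      using k by real_asymp
    moreover have "\<forall>\<^sub>F n in sequentially. s k \<le> (real n + 1) / (real n + 1 - real k) powr (real (Suc k) * nu)"
      using eventually_ge_at_top[of k]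
    proof eventually_elim
      case (elim n)
      have "s k * (real n + 1 - real k) powr (real (Suc k) * nu) \<le> s k * q n k"
        using q_lower[OF elim] s_nonneg by (intro mult_left_mono)
      also have "\<dots> \<le> (\<Sum>k\<le>n. s k * q n k)"
        using elim s_nonneg q_nonneg by (intro member_le_sum mult_nonneg_nonneg) auto
      also have "\<dots> = real n + 1" by (rule sum_eq)
      finally show ?case
        using elim by (simp add: pos_le_divide_eq del: of_nat_Suc)
    qed
    ultimately have "s k \<le> 0"
      by (intro tendsto_lowerbound[of _ 0 sequentially]) auto
    with s_nonneg[of k] show ?thesis by simp
  qed
  have s_lim: "(\<lambda>n. s k * (q n k / (real n + 1))) \<longlonglongrightarrow> (if real (Suc k) * nu = 1 then s k else 0)" for k
  proof (cases "real (Suc k) * nu" "1 :: real" rule: linorder_cases)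
    case less
    have "(\<lambda>n. q n k / (real n + 1)) \<longlonglongrightarrow> 0"
    proof (rule tendsto_sandwich[OF _ _ tendsto_const])
      show "(\<lambda>n. (real n + 1) powr (real (Suc k) * nu) / (real n + 1)) \<longlonglongrightarrow> 0"
        using less by real_asymp
      show "\<forall>\<^sub>F n in sequentially. 0 \<le> q n k / (real n + 1)"
        using q_nonneg by (auto intro!: always_eventually divide_nonneg_pos)
      show "\<forall>\<^sub>F n in sequentially. q n k / (real n + 1) \<le> (real n + 1) powr (real (Suc k) * nu) / (real n + 1)"
        using eventually_ge_at_top[of k] by eventually_elim (intro divide_right_mono q_upper, auto)
    qed
    from tendsto_mult_right_zero[OF this, of "s k"] show ?thesis using less by simp
  next
    case equal
    have "(\<lambda>n. q n k / (real n + 1)) \<longlonglongrightarrow> 1"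
    proof (rule tendsto_sandwich[OF _ _ _ tendsto_const])
      show "(\<lambda>n. (real n + 1 - real k) / (real n + 1)) \<longlonglongrightarrow> 1"
        by real_asymp
      show "\<forall>\<^sub>F n in sequentially. (real n + 1 - real k) / (real n + 1) \<le> q n k / (real n + 1)"
        using eventually_ge_at_top[of k]
      proof eventually_elim
        case (elim n)
        show ?case using q_lower[OF elim] elim unfolding equal by (intro divide_right_mono) auto
      qed
      show "\<forall>\<^sub>F n in sequentially. q n k / (real n + 1) \<le> 1"
        using eventually_ge_at_top[of k]
      proof eventually_elim
        case (elim n)
        show ?case using q_upper[OF elim] unfolding equal by simp
      qed
    qed
    then have "(\<lambda>n. s k * (q n k / (real n + 1))) \<longlonglongrightarrow> s k * 1"
      by (rule tendsto_mult_left)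
    then show ?thesis using equal by simp
  next
    case greater
    then show ?thesis using s_zero[OF greater] by simp
  qed
  \<comment> \<open>Beyond \<open>K\<close> all \<open>s k\<close> vanish, so the limit may be taken term by term.\<close>
  obtain K where K: "1 < real K * nu"
    using reals_Archimedean3[OF \<open>nu > 0\<close>] by blast
  have s_zero': "s k = 0" if "k \<ge> K" for k
  proof (rule s_zero)
    have "real K * nu \<le> real (Suc k) * nu"
      using that \<open>nu > 0\<close> by (intro mult_right_mono) auto
    with K show "1 < real (Suc k) * nu" by linarith
  qed
  have "(\<lambda>n. \<Sum>k<K. s k * (q n k / (real n + 1))) \<longlonglongrightarrow> (\<Sum>k<K. if real (Suc k) * nu = 1 then s k else 0)"
    by (intro tendsto_sum s_lim)
  moreover have "\<forall>\<^sub>F n in sequentially. (\<Sum>k<K. s k * (q n k / (real n + 1))) = 1"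
    using eventually_ge_at_top[of K]
  proof eventually_elim
    case (elim n)
    have "(\<Sum>k<K. s k * q n k) = (\<Sum>k\<le>n. s k * q n k)"
      using elim s_zero' by (intro sum.mono_neutral_left) auto
    then show ?case
      using sum_eq[of n] by (simp add: sum_divide_distrib[symmetric])
  qed
  ultimately have "((\<lambda>_::nat. 1) \<longlongrightarrow> (\<Sum>k<K. if real (Suc k) * nu = 1 then s k else 0)) sequentially"
    by (blast intro: Lim_transform_eventually)
  then have sum_1: "(\<Sum>k<K. if real (Suc k) * nu = 1 then s k else 0) = 1"
    by (simp add: LIMSEQ_const_iff)
  have "\<exists>k0<K. real (Suc k0) * nu = 1"
  proof (rule ccontr)
    assume "\<not> ?thesis"
    then have "(\<Sum>k<K. if real (Suc k) * nu = 1 then s k else 0) = 0"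
      by (intro sum.neutral) auto
    with sum_1 show False by linarith
  qed
  then obtain k0 where k0: "k0 < K" "real (Suc k0) * nu = 1" by blast
  have "real (Suc k) * nu = 1 \<longleftrightarrow> k = k0" for k
  proof -
    have "real (Suc k) * nu = 1 \<longleftrightarrow> real (Suc k) * nu = real (Suc k0) * nu"
      by (simp only: k0(2))
    also have "\<dots> \<longleftrightarrow> k = k0"
      using \<open>nu > 0\<close> by simp
    finally show ?thesis .
  qed
  then have sk0: "s k0 = 1"
    using sum_1 k0(1) by (simp only: sum.delta finite_lessThan lessThan_iff if_True)
  have "k0 \<noteq> 0" using k0(2) \<open>nu < 1\<close> by (intro notI) simp
  have bound: "(real n + 1) powr nu \<le> real k0" if "n \<ge> k0" for n
  proof -
    have "(real n + 1) powr nu + (real n + 1 - real k0) \<le> s 0 * q n 0 + s k0 * q n k0"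
      using q_lower[of 0 n] q_lower[OF that] that unfolding k0(2) by (simp add: s0 sk0)
    also have "\<dots> = (\<Sum>k\<in>{0, k0}. s k * q n k)"
      using \<open>k0 \<noteq> 0\<close> by simp
    also have "\<dots> \<le> (\<Sum>k\<le>n. s k * q n k)"
      using that s_nonneg q_nonneg by (intro sum_mono2 mult_nonneg_nonneg) auto
    finally show ?thesis by (simp add: sum_eq)
  qed
  have "filterlim (\<lambda>n. (real n + 1) powr nu) at_top sequentially"
    using \<open>nu > 0\<close> by real_asymp
  then have "\<forall>\<^sub>F n in sequentially. real k0 + 1 \<le> (real n + 1) powr nu"
    by (auto simp: filterlim_at_top)
  with eventually_ge_at_top[of k0] have "\<forall>\<^sub>F n in sequentially. False"
    by eventually_elim (use bound in force)
  then show False by simp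
qed

section \<open>Coefficients of compound Poisson generating functions\<close>

text \<open>
  A function of the form \<open>G = exp H\<close> satisfies \<open>G' = H' * G\<close>; comparing coefficients
  turns this into a recursion for the coefficients of \<open>G\<close>. The constants \<open>- c k\<close> in the
  exponent multiply \<open>G\<close> by a constant factor and cancel in \<open>G' / G\<close>.
\<close>
lemma exp_series_recursion:
  fixes P :: "complex fps" and c :: "nat \<Rightarrow> complex"
  assumes P: "fps_conv_radius P > 0" and c: "summable (\<lambda>k. norm (c k))"
    and eq: "\<And>z. norm z \<le> 1 \<Longrightarrow> eval_fps P z = exp (\<Sum>k. c k * (z ^ Suc k - 1))"
  shows "of_nat (Suc n) * fps_nth P (Suc n) = (\<Sum>k\<le>n. of_nat (Suc k) * c k * fps_nth P (n - k))"
proof -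
  define H :: "complex fps" where "H = Abs_fps (\<lambda>n. case n of 0 \<Rightarrow> 0 | Suc k \<Rightarrow> c k)"
  define C where "C = (\<Sum>k. c k)"
  have H_nth [simp]: "fps_nth H 0 = 0" "fps_nth H (Suc k) = c k" for k
    by (simp_all add: H_def)
  have c_sum: "summable c" using c by (rule summable_norm_cancel)
  have pow_sum: "summable (\<lambda>k. c k * z ^ Suc k)" if "norm z \<le> 1" for z
  proof (rule summable_comparison_test[OF _ c], intro exI allI impI)
    fix k
    show "norm (c k * z ^ Suc k) \<le> norm (c k)"
      using that mult_left_mono[OF power_le_one[of "norm z" "Suc k"], of "norm (c k)"]
      by (simp add: norm_mult norm_power del: power_Suc)
  qed
  have H_eval: "eval_fps H z = (\<Sum>k. c k * z ^ Suc k)" if "norm z \<le> 1" for z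
  proof -
    have "summable (\<lambda>n. fps_nth H n * z ^ n)"
      using pow_sum[OF that] by (subst summable_Suc_iff[symmetric]) (simp del: power_Suc)
    from suminf_split_head[OF this] show ?thesis
      by (simp add: eval_fps_def del: power_Suc)
  qed
  have "summable (\<lambda>n. fps_nth H n * 1 ^ n)"
    using c_sum by (subst summable_Suc_iff[symmetric]) simp
  from conv_radius_geI[OF this] have "fps_conv_radius H \<ge> 1"
    by (simp add: fps_conv_radius_def one_ereal_def)
  then have "fps_conv_radius H > 0"
    by (rule less_le_trans[rotated]) simp
  have "(exp \<circ> eval_fps H) has_fps_expansion (fps_exp 1 oo H)"
    by (intro has_fps_expansion_compose has_fps_expansion_exp1 eval_fps_has_fps_expansion) fact+
  then have "(\<lambda>z. exp (- C) * (exp \<circ> eval_fps H) z) has_fps_expansion fps_const (exp (- C)) * (fps_exp 1 oo H)"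
    by (rule has_fps_expansion_cmult_left)
  moreover have "\<forall>\<^sub>F z in nhds 0. exp (- C) * (exp \<circ> eval_fps H) z = eval_fps P z"
  proof -
    have "\<forall>\<^sub>F z in nhds 0. z \<in> ball (0::complex) 1"
      by (intro eventually_nhds_in_open) auto
    then show ?thesis
    proof eventually_elim
      case (elim z)
      then have z: "norm z \<le> 1" by simp
      have "(\<Sum>k. c k * (z ^ Suc k - 1)) = (\<Sum>k. c k * z ^ Suc k) - C"
        unfolding C_def right_diff_distrib mult_1_right
        by (rule suminf_diff[OF pow_sum[OF z] c_sum, symmetric])
      then show ?case
        unfolding eq[OF z] comp_def H_eval[OF z] by (simp only: mult_exp_exp uminus_add_conv_diff)
    qed
  qed
  ultimately have "eval_fps P has_fps_expansion fps_const (exp (- C)) * (fps_exp 1 oo H)"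
    by (subst (asm) has_fps_expansion_cong[OF _ refl])
  then have P_eq: "P = fps_const (exp (- C)) * (fps_exp 1 oo H)"
    by (rule fps_expansion_unique_complex[OF eval_fps_has_fps_expansion[OF P]])
  then have "fps_deriv P = fps_deriv H * P"
    by (simp add: fps_compose_deriv mult_ac)
  then have "fps_nth (fps_deriv P) n = fps_nth (fps_deriv H * P) n"
    by simp
  then show ?thesis
    by (simp add: fps_mult_nth atLeast0AtMost)
qed

text \<open>
  The point probabilities of a discrete compound Poisson variable satisfy Panjer's recursion; what
  matters below is that its weights \<open>r k\<close> are nonnegative.
\<close>
lemma DCP_recursion:
  assumes "prob_space M" "DCP_distributed M X"
  obtains r :: "nat \<Rightarrow> real" where "\<And>k. r k \<ge> 0"
    "\<And>n. real (Suc n) * \<P>(\<omega> in M. X \<omega> = Suc n) = (\<Sum>k\<le>n. r k * \<P>(\<omega> in M. X \<omega> = n - k))"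
proof -
  interpret prob_space M by fact
  from assms(2) obtain lam \<alpha> where "lam > 0" and \<alpha>: "\<And>k. k \<ge> 1 \<Longrightarrow> \<alpha> k \<ge> (0::real)"
    and sum: "summable (\<lambda>k. lam * \<alpha> (Suc k))"
    and pgf: "\<And>z. norm z \<le> 1 \<Longrightarrow>
           pgf M X z = exp (\<Sum>k. complex_of_real (\<alpha> (Suc k) * lam) * (z ^ Suc k - 1))"
    unfolding DCP_distributed_def by blast
  define p where "p n = \<P>(\<omega> in M. X \<omega> = n)" for n
  define P where "P = Abs_fps (\<lambda>n. complex_of_real (p n))"
  \<comment> \<open>Any point of the open unit disc other than 0 would do: the coefficients are at most 1.\<close>
  have "summable (\<lambda>n. fps_nth P n * (1/2) ^ n)"
  proof (rule summable_comparison_test)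
    show "summable (\<lambda>n. (1/2 :: real) ^ n)" by (rule summable_geometric) simp
    have "norm (fps_nth P n * (1/2) ^ n) \<le> (1/2) ^ n" for n
      by (simp add: P_def p_def norm_mult norm_power norm_divide power_divide divide_right_mono)
    then show "\<exists>N. \<forall>n\<ge>N. norm (fps_nth P n * (1/2) ^ n) \<le> (1/2) ^ n" by blast
  qed
  from conv_radius_geI[OF this] have "fps_conv_radius P \<ge> ereal (1/2)"
    by (simp add: fps_conv_radius_def norm_divide)
  then have P: "fps_conv_radius P > 0"
    by (rule less_le_trans[rotated]) simp
  have c: "summable (\<lambda>k. norm (complex_of_real (\<alpha> (Suc k) * lam)))"
    using sum \<alpha> \<open>lam > 0\<close> by (simp add: norm_mult mult.commute abs_mult)
  have "eval_fps P z = pgf M X z" for z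
    by (simp add: eval_fps_def pgf_def P_def p_def)
  note rec = exp_series_recursion[OF P c, unfolded this, OF pgf]
  show thesis
  proof
    show "real (Suc k) * (\<alpha> (Suc k) * lam) \<ge> 0" for k
      using \<alpha>[of "Suc k"] \<open>lam > 0\<close> by (intro mult_nonneg_nonneg) auto
    show "real (Suc n) * \<P>(\<omega> in M. X \<omega> = Suc n) =
        (\<Sum>k\<le>n. real (Suc k) * (\<alpha> (Suc k) * lam) * \<P>(\<omega> in M. X \<omega> = n - k))" for n
    proof -
      have "complex_of_real (real (Suc n) * p (Suc n)) =
          complex_of_real (\<Sum>k\<le>n. real (Suc k) * (\<alpha> (Suc k) * lam) * p (n - k))"
        using rec[of n] by (simp add: P_def)
      then show ?thesis
        unfolding of_real_eq_iff p_def .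
    qed
  qed
qed

section \<open>COM-Poisson variables\<close>

text \<open>
  If the normalising constant were 0, division by 0 would make every point probability 0, contrary
  to countable additivity.
\<close>
lemma CMP_Z_nonzero:
  assumes "prob_space M" "CMP_distributed M X lam nu"
  shows "CMP_Z lam nu \<noteq> 0"
proof
  interpret prob_space M by fact
  assume "CMP_Z lam nu = 0"
  have [measurable]: "X \<in> measurable M (count_space UNIV)"
    using assms(2) by (simp add: CMP_distributed_def)
  have "AE \<omega> in M. X \<omega> \<noteq> k" for k
  proof -
    have "\<P>(\<omega> in M. X \<omega> = k) = 0"
      using assms(2) \<open>CMP_Z lam nu = 0\<close> by (simp add: CMP_distributed_def)
    then show ?thesis
      by (subst (asm) prob_eq_0) auto
  qed
  then have "AE \<omega> in M. \<forall>k. X \<omega> \<noteq> k"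
    unfolding AE_all_countable by blast
  then show False by simp
qed

lemma prob_sum_indep_eq_convolution:
  assumes "prob_space M"
    and indep: "prob_space.indep_var M (count_space UNIV) X (count_space UNIV) (Y :: 'a \<Rightarrow> nat)"
  shows "\<P>(\<omega> in M. X \<omega> + Y \<omega> = n) =
    (\<Sum>i\<le>n. \<P>(\<omega> in M. X \<omega> = i) * \<P>(\<omega> in M. Y \<omega> = n - i))"
proof -
  interpret prob_space M by fact
  have [measurable]: "X \<in> measurable M (count_space UNIV)" "Y \<in> measurable M (count_space UNIV)"
    using indep_var_rv1[OF indep] indep_var_rv2[OF indep] by simp_all
  have "{\<omega> \<in> space M. X \<omega> + Y \<omega> = n} = (\<Union>i\<le>n. {\<omega> \<in> space M. X \<omega> = i \<and> Y \<omega> = n - i})"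
    by auto
  also have "prob \<dots> = (\<Sum>i\<le>n. \<P>(\<omega> in M. X \<omega> = i \<and> Y \<omega> = n - i))"
    by (intro finite_measure_finite_Union) (auto simp: disjoint_family_on_def)
  also have "\<dots> = (\<Sum>i\<le>n. \<P>(\<omega> in M. X \<omega> = i) * \<P>(\<omega> in M. Y \<omega> = n - i))"
  proof (intro sum.cong refl)
    fix i
    show "\<P>(\<omega> in M. X \<omega> = i \<and> Y \<omega> = n - i) = \<P>(\<omega> in M. X \<omega> = i) * \<P>(\<omega> in M. Y \<omega> = n - i)"
      using indep_varD[OF indep, of "{i}" "{n - i}"] by (simp add: vimage_def Int_def conj_commute)
  qed
  finally show ?thesis .
qed

lemma CMP_family_sum_imp_exponent_eq_1:
  assumes "prob_space M"
    and "X \<in> CMP_family M nu" "Y \<in> CMP_family M nu" "(\<lambda>\<omega>. X \<omega> + Y \<omega>) \<in> CMP_family M nu"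
    and indep: "prob_space.indep_var M (count_space UNIV) X (count_space UNIV) Y"
  shows "nu = 1"
proof -
  obtain a b c where pos: "a > 0" "b > 0" "c > 0"
    and X: "CMP_distributed M X a nu" and Y: "CMP_distributed M Y b nu"
    and S: "CMP_distributed M (\<lambda>\<omega>. X \<omega> + Y \<omega>) c nu"
    using assms(2-4) by (auto simp: CMP_family_def)
  define A where "A = 1 / CMP_Z a nu"
  define B where "B = 1 / CMP_Z b nu"
  define C where "C = 1 / CMP_Z c nu"
  define t :: real where "t = 2 powr nu"
  have nonzero: "A \<noteq> 0" "B \<noteq> 0"
    using CMP_Z_nonzero[OF assms(1)] X Y by (auto simp: A_def B_def)
  have "t > 0" by (simp add: t_def)
  have conv: "c ^ n / fact n powr nu * C =
      (\<Sum>i\<le>n. (a ^ i / fact i powr nu * A) * (b ^ (n - i) / fact (n - i) powr nu * B))" for n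
    using prob_sum_indep_eq_convolution[OF assms(1) indep, of n] X Y S
    by (simp add: CMP_distributed_def A_def B_def C_def)
  have C: "C = A * B"
    using conv[of 0] by simp
  have "A * B * c = A * B * (a + b)"
    using conv[of 1] by (simp add: C algebra_simps)
  then have c: "c = a + b"
    using nonzero by simp
  have "A * B * (c\<^sup>2 / t) = A * B * (a\<^sup>2 / t + a * b + b\<^sup>2 / t)"
    using conv[of 2] by (simp add: C t_def atMost_Suc eval_nat_numeral algebra_simps)
  then have "c\<^sup>2 / t = a\<^sup>2 / t + a * b + b\<^sup>2 / t"
    using nonzero by (subst (asm) mult_left_cancel) simp_all
  then have "(a * b) * t = (a * b) * 2"
    using \<open>t > 0\<close> by (simp add: c field_simps power2_eq_square)
  then have "2 powr nu = 2 powr (1 :: real)"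
    using pos by (simp add: t_def)
  then show ?thesis
    by (subst (asm) powr_inj) auto
qed

lemma CMP_and_DCP_imp_exponent_eq_1:
  assumes "prob_space M" "nu > 0" "lam > 0"
    and X: "CMP_distributed M X lam nu" and "DCP_distributed M X"
  shows "nu = 1"
proof -
  obtain r :: "nat \<Rightarrow> real" where r: "\<And>k. r k \<ge> 0"
    and rec: "\<And>n. real (Suc n) * \<P>(\<omega> in M. X \<omega> = Suc n) = (\<Sum>k\<le>n. r k * \<P>(\<omega> in M. X \<omega> = n - k))"
    using DCP_recursion[OF assms(1,5)] by blast
  define Z where "Z = CMP_Z lam nu"
  have "Z \<noteq> 0"
    using CMP_Z_nonzero[OF assms(1) X] by (simp add: Z_def)
  have p: "\<P>(\<omega> in M. X \<omega> = k) = lam ^ k / fact k powr nu * (1 / Z)" for k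
    using X by (simp add: CMP_distributed_def Z_def)
  show ?thesis
  proof (rule nonneg_convolution_imp_exponent_eq_1[OF \<open>nu > 0\<close>])
    show "r k / lam ^ Suc k \<ge> 0" for k
      using r[of k] \<open>lam > 0\<close> by simp
    show "(real n + 1) / fact (Suc n) powr nu =
        (\<Sum>k\<le>n. r k / lam ^ Suc k / fact (n - k) powr nu)" for n
    proof -
      have "(\<Sum>k\<le>n. r k / lam ^ Suc k / fact (n - k) powr nu) =
          (\<Sum>k\<le>n. Z / lam ^ Suc n * (r k * \<P>(\<omega> in M. X \<omega> = n - k)))"
      proof (rule sum.cong[OF refl])
        fix k assume "k \<in> {..n}"
        then have "lam ^ Suc n = lam ^ Suc k * lam ^ (n - k)"
          by (simp flip: power_add)
        then show "r k / lam ^ Suc k / fact (n - k) powr nu =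
            Z / lam ^ Suc n * (r k * \<P>(\<omega> in M. X \<omega> = n - k))"
          using \<open>lam > 0\<close> \<open>Z \<noteq> 0\<close> by (simp add: p field_simps del: power_Suc)
      qed
      also have "\<dots> = Z / lam ^ Suc n * (real (Suc n) * \<P>(\<omega> in M. X \<omega> = Suc n))"
        by (simp only: rec sum_distrib_left)
      also have "\<dots> = (real n + 1) / fact (Suc n) powr nu"
        using \<open>lam > 0\<close> \<open>Z \<noteq> 0\<close> by (simp add: p field_simps del: power_Suc fact_Suc)
      finally show ?thesis ..
    qed
  qed
qed

theorem corollary4p1:
  fixes nu :: real and M :: "'a measure"
  assumes "nu > 0" and "nu \<noteq> 1" and "prob_space M"
  shows "(\<forall>X Y. X \<in> CMP_family M nu \<longrightarrow> Y \<in> CMP_family M nu \<longrightarrow>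
            prob_space.indep_var M (count_space UNIV) X (count_space UNIV) Y \<longrightarrow>
            (\<lambda>\<omega>. X \<omega> + Y \<omega>) \<notin> CMP_family M nu)
       \<and> (\<forall>X lam. lam > 0 \<longrightarrow> CMP_distributed M X lam nu \<longrightarrow> \<not> DCP_distributed M X)"
  using CMP_family_sum_imp_exponent_eq_1[OF assms(3)]
    CMP_and_DCP_imp_exponent_eq_1[OF assms(3,1)] assms(2)
  by blast

end
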